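(* Let $I\subseteq\mathbb{R}$ be an interval with interior $I^{\circ}$, let $f:I\to\mathbb{R}$ be differentiable on $I^{\circ}$ and such that $f'\in L[a,b]$, where $a,b\in I$ with $a<b$. If $|f'|$ is convex on $[a,b]$, then for each $x\in[a,b]$, $$\left|\frac{(b-x)f(b)+(x-a)f(a)}{b-a}-\frac{1}{b-a}\int_a^b f(u)\,du\right|\le \frac{(x-a)^2}{b-a}\left[\frac{|f'(x)|+2|f'(a)|}{6}\right]+\frac{(b-x)^2}{b-a}\left[\frac{|f'(x)|+2|f'(b)|}{6}\right].$$
   Context: $f'\in L[a,b]$ means that $f'$ is (Lebesgue) integrable on $[a,b]$. *)

theory Defs
  imports "HOL-Analysis.Analysis"
begin

end

theory Submission
  imports Defs
begin

text \<open>
  Integrating the derivative of \<open>(u - x) f(u)\<close> shows that the left-hand side is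
  \<open>1 / (b - a)\<close> times the absolute value of the integral of \<open>(u - x) f'(u)\<close> over \<open>[a, b]\<close>.
  Split this integral at \<open>x\<close> and, on each piece, bound \<open>\<bar>f'\<bar>\<close> by its chord.
\<close>

lemma convex_on_le_chord:
  fixes g :: "real \<Rightarrow> real"
  assumes "convex_on {c..d} g" "t \<in> {c..d}"
  shows "g t \<le> g c + (t - c) / (d - c) * (g d - g c)"
  using convex_onD_Icc'[OF assms] by (simp add: algebra_simps)

text \<open>This is the source of the constants 1, 2 and 6 in the final bound: with \<open>p\<close>
  and \<open>q\<close> the end values of a chord, integrating the weight times the chord gives
  \<open>p / 2 + (q - p) / 3 = (p + 2 * q) / 6\<close>. The end where the weight vanishes counts
  half as much as the other.\<close>

lemma has_integral_weighted_chord: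
  fixes c d p q :: real
  assumes "c < d"
  shows "((\<lambda>t. (t - c) * (p + (t - c) / (d - c) * (q - p)))
           has_integral (d - c)\<^sup>2 * ((p + 2 * q) / 6)) {c..d}"
proof -
  \<comment> \<open>Naming the slope keeps the antiderivative a polynomial; the quotient is removed
    only at the end, through \<open>k * (d - c) = q - p\<close>.\<close>
  define k where "k = (q - p) / (d - c)"
  have k: "k * (d - c) = q - p"
    using assms by (simp add: k_def)
  let ?F = "\<lambda>t. p / 2 * (t - c)\<^sup>2 + k / 3 * (t - c) ^ 3"
  have "(?F has_real_derivative (t - c) * (p + k * (t - c))) (at t within {c..d})" for t
    by (auto intro!: derivative_eq_intros simp: power2_eq_square field_simps)
  then have "((\<lambda>t. (t - c) * (p + k * (t - c))) has_integral ?F d - ?F c) {c..d}"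
    using assms by (intro fundamental_theorem_of_calculus)
      (auto simp: has_real_derivative_iff_has_vector_derivative)
  also have "?F d - ?F c = (d - c)\<^sup>2 * (p / 2 + k * (d - c) / 3)"
    by (simp add: power2_eq_square power3_eq_cube field_simps)
  also have "\<dots> = (d - c)\<^sup>2 * ((p + 2 * q) / 6)"
    unfolding k by (simp add: field_simps)
  finally show ?thesis
    by (simp add: k_def mult.commute)
qed

lemma weighted_integral_bound_left:
  fixes g :: "real \<Rightarrow> real"
  assumes "c \<le> d" and "convex_on {c..d} (\<lambda>t. \<bar>g t\<bar>)"
    and J: "((\<lambda>t. (t - c) * g t) has_integral J) {c..d}"
  shows "\<bar>J\<bar> \<le> (d - c)\<^sup>2 * ((\<bar>g c\<bar> + 2 * \<bar>g d\<bar>) / 6)"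
proof (cases "c = d")
  \<comment> \<open>A degenerate interval must be allowed, since x may be an endpoint of [a, b]. The
    chord integral requires \<open>c < d\<close>, but here \<open>J\<close> and the bound are both
    0.\<close>
  case True
  then show ?thesis
    using J has_integral_unique[OF _ has_integral_refl(2)] by fastforce
next
  case False
  then have "c < d" using assms(1) by simp
  note B = has_integral_weighted_chord[OF this, of "\<bar>g c\<bar>" "\<bar>g d\<bar>"]
  have "norm ((t - c) * g t) \<le> (t - c) * (\<bar>g c\<bar> + (t - c) / (d - c) * (\<bar>g d\<bar> - \<bar>g c\<bar>))"
    if "t \<in> {c..d}" for t
    using convex_on_le_chord[OF assms(2) that] that
    by (auto simp: abs_mult intro!: mult_left_mono)
  then have "norm (integral {c..d} (\<lambda>t. (t - c) * g t))
      \<le> integral {c..d} (\<lambda>t. (t - c) * (\<bar>g c\<bar> + (t - c) / (d - c) * (\<bar>g d\<bar> - \<bar>g c\<bar>)))"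
    using J B by (intro integral_norm_bound_integral) (auto simp: has_integral_integrable)
  then show ?thesis
    using integral_unique[OF J] integral_unique[OF B] by simp
qed

text \<open>The reflection t -> -t moves the zero of the weight from the right end to the left end,
  which reduces this to \<open>weighted_integral_bound_left\<close>.\<close>

lemma weighted_integral_bound_right:
  fixes g :: "real \<Rightarrow> real"
  assumes "c \<le> d" and conv: "convex_on {c..d} (\<lambda>t. \<bar>g t\<bar>)"
    and J: "((\<lambda>t. (t - d) * g t) has_integral J) {c..d}"
  shows "\<bar>J\<bar> \<le> (d - c)\<^sup>2 * ((\<bar>g d\<bar> + 2 * \<bar>g c\<bar>) / 6)"
proof -
  have "((\<lambda>t. (- t - d) * g (- t)) has_integral J) {- d..- c}"
    using J by (subst has_integral_reflect_real) auto
  \<comment> \<open>The minus sign produced by reflecting the weight is moved onto \<open>g\<close>,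
    where the absolute value absorbs it.\<close>
  then have "((\<lambda>t. (t - (- d)) * (- g (- t))) has_integral J) {- d..- c}"
    by (simp add: algebra_simps)
  moreover have "convex_on {- d..- c} (\<lambda>t. \<bar>- g (- t)\<bar>)"
  proof (rule convex_onI)
    fix t y z :: real
    assume "0 < t" "t < 1" "y \<in> {- d..- c}" "z \<in> {- d..- c}"
    then show "\<bar>- g (- ((1 - t) *\<^sub>R y + t *\<^sub>R z))\<bar>
        \<le> (1 - t) * \<bar>- g (- y)\<bar> + t * \<bar>- g (- z)\<bar>"
      using convex_onD[OF conv, of t "- y" "- z"] by (simp add: algebra_simps)
  qed simp
  ultimately show ?thesis
    using weighted_integral_bound_left[of "- d" "- c" "\<lambda>t. - g (- t)" J] \<open>c \<le> d\<close> by simp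
qed

text \<open>Integration by parts for the gauge integral, whose fundamental theorem covers
  derivatives that may be discontinuous. Continuity of \<open>f\<close> lets its integral be
  subtracted afterwards.\<close>

lemma has_integral_weighted_derivative:
  fixes f f' :: "real \<Rightarrow> real"
  assumes "c \<le> d" and "\<And>u. u \<in> {c..d} \<Longrightarrow> (f has_real_derivative f' u) (at u within {c..d})"
  shows "((\<lambda>u. (u - x) * f' u)
           has_integral (d - x) * f d - (c - x) * f c - integral {c..d} f) {c..d}"
proof -
  have "((\<lambda>u. (u - x) * f u) has_real_derivative f u + (u - x) * f' u) (at u within {c..d})"
    if "u \<in> {c..d}" for u
    using assms(2)[OF that] by (auto intro!: derivative_eq_intros)
  then have "((\<lambda>u. f u + (u - x) * f' u) has_integral (d - x) * f d - (c - x) * f c) {c..d}"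
    using assms(1) by (intro fundamental_theorem_of_calculus)
      (auto simp: has_real_derivative_iff_has_vector_derivative)
  moreover have "continuous_on {c..d} f"
    using assms(2) by (intro DERIV_continuous_on)
  then have "(f has_integral integral {c..d} f) {c..d}"
    by (intro integrable_integral integrable_continuous_real)
  ultimately show ?thesis
    by (auto dest: has_integral_diff)
qed

theorem theorem3:
  fixes I :: "real set" and f f' :: "real \<Rightarrow> real" and a b x :: real
  assumes "is_interval I"
    and "\<And>u. u \<in> interior I \<Longrightarrow> (f has_real_derivative f' u) (at u)"
    and "a \<in> I" and "b \<in> I" and "a < b"
    and "\<And>u. u \<in> {a..b} \<Longrightarrow> (f has_real_derivative f' u) (at u within I)"
    and "set_integrable lebesgue {a..b} f'"
    and "convex_on {a..b} (\<lambda>u. \<bar>f' u\<bar>)"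
    and "x \<in> {a..b}"
  shows "\<bar>((b - x) * f b + (x - a) * f a) / (b - a)
            - 1 / (b - a) * (LINT u:{a..b}|lebesgue. f u)\<bar>
         \<le> (x - a)\<^sup>2 / (b - a) * ((\<bar>f' x\<bar> + 2 * \<bar>f' a\<bar>) / 6)
           + (b - x)\<^sup>2 / (b - a) * ((\<bar>f' x\<bar> + 2 * \<bar>f' b\<bar>) / 6)"
proof -
  have x: "a \<le> x" "x \<le> b" using assms(9) by auto
  have "{a..b} \<subseteq> I"
    using assms(1,3,4) unfolding is_interval_1 by (meson atLeastAtMost_iff subsetI)
  then have der: "(f has_real_derivative f' u) (at u within {c..d})"
    if "u \<in> {c..d}" "{c..d} \<subseteq> {a..b}" for u c d
    using that assms(6)[of u] by (meson DERIV_subset order_trans subsetD)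
  have "continuous_on {a..b} f"
    using der by (intro DERIV_continuous_on[where D = f']) auto
  \<comment> \<open>The lemmas above use the gauge integral; for the continuous function
    \<open>f\<close> it agrees with the Lebesgue integral of the statement.\<close>
  have LINT: "(LINT u:{a..b}|lebesgue. f u) = integral {a..b} f"
    using \<open>continuous_on {a..b} f\<close>
    by (intro set_lebesgue_integral_eq_integral absolutely_integrable_continuous_real)
  have split: "integral {a..x} f + integral {x..b} f = integral {a..b} f"
    using x \<open>continuous_on {a..b} f\<close>
    by (intro Henstock_Kurzweil_Integration.integral_combine integrable_continuous_real)
  \<comment> \<open>These are the integrals of (u - x) f'(u) over the two pieces: the weight
    vanishes at u = x, so only the boundary terms at a and b survive.\<close>
  let ?A = "(x - a) * f a - integral {a..x} f" and ?B = "(b - x) * f b - integral {x..b} f"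
  have "\<bar>?A\<bar> \<le> (x - a)\<^sup>2 * ((\<bar>f' x\<bar> + 2 * \<bar>f' a\<bar>) / 6)"
  proof (rule weighted_integral_bound_right)
    show "((\<lambda>u. (u - x) * f' u) has_integral ?A) {a..x}"
      using has_integral_weighted_derivative[of a x f f' x] der[of _ a x] x
      by (simp add: algebra_simps)
  qed (use x assms(8) in \<open>auto intro: convex_on_subset\<close>)
  moreover have "\<bar>?B\<bar> \<le> (b - x)\<^sup>2 * ((\<bar>f' x\<bar> + 2 * \<bar>f' b\<bar>) / 6)"
  proof (rule weighted_integral_bound_left)
    show "((\<lambda>u. (u - x) * f' u) has_integral ?B) {x..b}"
      using has_integral_weighted_derivative[of x b f f' x] der[of _ x b] x by simp
  qed (use x assms(8) in \<open>auto intro: convex_on_subset\<close>)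
  ultimately have "\<bar>?A + ?B\<bar> \<le> (x - a)\<^sup>2 * ((\<bar>f' x\<bar> + 2 * \<bar>f' a\<bar>) / 6)
      + (b - x)\<^sup>2 * ((\<bar>f' x\<bar> + 2 * \<bar>f' b\<bar>) / 6)" (is "_ \<le> ?R")
    by linarith
  then have "\<bar>(?A + ?B) / (b - a)\<bar> \<le> ?R / (b - a)"
    using \<open>a < b\<close> by (simp only: abs_divide) (simp add: divide_right_mono)
  moreover have "((b - x) * f b + (x - a) * f a) / (b - a)
      - 1 / (b - a) * (LINT u:{a..b}|lebesgue. f u) = (?A + ?B) / (b - a)"
    unfolding LINT split[symmetric] by (simp add: diff_divide_distrib add_divide_distrib)
  moreover have "?R / (b - a) = (x - a)\<^sup>2 / (b - a) * ((\<bar>f' x\<bar> + 2 * \<bar>f' a\<bar>) / 6)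
      + (b - x)\<^sup>2 / (b - a) * ((\<bar>f' x\<bar> + 2 * \<bar>f' b\<bar>) / 6)"
    by (simp add: add_divide_distrib)
  ultimately show ?thesis
    by (simp only:)
qed

end
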